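(* For any compact ultrametric spaces $X,Y$ and any $p\in[1,\infty]$, $$2^{-\frac1p}\,d_{\mathrm{I},p}(X,Y)\leq d_{\mathrm{GH}}^{(p)}(X,Y)\leq d_{\mathrm{I},p}(X,Y).$$
   Context: All metric spaces are nonempty. Convention $\frac1\infty=0$. For $a,b\ge 0$: $a\boxplus_p b=(a^p+b^p)^{1/p}$ for $p<\infty$, $a\boxplus_\infty b=\max(a,b)$; $\Lambda_p(a,b)=|a^p-b^p|^{1/p}$ for $p<\infty$; $\Lambda_\infty(a,b)=\max(a,b)$ if $a\ne b$ and $0$ if $a=b$. Then $$d_{\mathrm{GH}}^{(p)}(X,Y)=2^{-\frac1p}\inf_R\ \sup_{(x,y),(x',y')\in R}\Lambda_p(d_X(x,x'),d_Y(y,y')),$$ with $R$ ranging over all correspondences between $X$ and $Y$ (subsets of $X\times Y$ projecting onto both factors). For a compact ultrametric space $(X,u_X)$, the associated dendrogram $\theta_X$ assigns to $t\ge0$ the partition of $X$ into blocks $[x]^{\theta_X}_t=\{x':u_X(x,x')\le t\}$. For $\varepsilon>0$, $X$ and $Y$ are $(\varepsilon,p)$-interleaved if there exist set maps $\varphi:X\to Y$, $\psi:Y\to X$ such that for all $t\ge0$, $x\in X$, $y\in Y$: (1) $\varphi([x]^{\theta_X}_t)\subseteq[\varphi(x)]^{\theta_Y}_{t\boxplus_p\varepsilon}$ and $\psi([y]^{\theta_Y}_t)\subseteq[\psi(y)]^{\theta_X}_{t\boxplus_p\varepsilon}$; (2) $[x]^{\theta_X}_{t\boxplus_p\varepsilon\boxplus_p\varepsilon}=[\psi\circ\varphi(x)]^{\theta_X}_{t\boxplus_p\varepsilon\boxplus_p\varepsilon}$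 and $[y]^{\theta_Y}_{t\boxplus_p\varepsilon\boxplus_p\varepsilon}=[\varphi\circ\psi(y)]^{\theta_Y}_{t\boxplus_p\varepsilon\boxplus_p\varepsilon}$. The $p$-interleaving distance is $d_{\mathrm{I},p}(X,Y)=\inf\{\varepsilon>0: X,Y\text{ are }(\varepsilon,p)\text{-interleaved}\}$. *)

theory Defs
  imports "HOL-Analysis.Analysis"
begin

locale Ultrametric_space = Metric_space +
  assumes strong_triangle:
    "\<lbrakk>x \<in> M; y \<in> M; z \<in> M\<rbrakk> \<Longrightarrow> d x z \<le> max (d x y) (d y z)"

text \<open>The exponent \<open>p\<close> is an extended real in \<open>[1, \<infinity>]\<close>; the following two operations are meant for
  nonnegative real arguments. Since \<open>p \<noteq> 0\<close>, the convention \<open>0 powr a = 0\<close> gives the right value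
  of \<open>0\<^sup>p\<close>.\<close>

definition boxplus :: "ereal \<Rightarrow> real \<Rightarrow> real \<Rightarrow> real" where
  "boxplus p a b =
     (if p = \<infinity> then max a b
      else (a powr real_of_ereal p + b powr real_of_ereal p) powr (1 / real_of_ereal p))"

definition Lambda :: "ereal \<Rightarrow> real \<Rightarrow> real \<Rightarrow> real" where
  "Lambda p a b =
     (if p = \<infinity> then (if a = b then 0 else max a b)
      else \<bar>a powr real_of_ereal p - b powr real_of_ereal p\<bar> powr (1 / real_of_ereal p))"

text \<open>The number \<open>2\<^bsup>-1/p\<^esup>\<close>; in \<^typ>\<open>ereal\<close>, \<open>1 / \<infinity> = 0\<close>, so it is \<open>1\<close> for \<open>p = \<infinity>\<close>.\<close>

definition two_powr_neg_inv :: "ereal \<Rightarrow> real" where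
  "two_powr_neg_inv p = 2 powr (- real_of_ereal (1 / p))"

definition correspondence :: "'a set \<Rightarrow> 'b set \<Rightarrow> ('a \<times> 'b) set \<Rightarrow> bool" where
  "correspondence X Y R \<longleftrightarrow> R \<subseteq> X \<times> Y \<and> fst ` R = X \<and> snd ` R = Y"

text \<open>Both distances below take values in \<^typ>\<open>ereal\<close>, so that all suprema and infima exist
  without side conditions.\<close>

definition GH_dist ::
  "ereal \<Rightarrow> 'a set \<Rightarrow> ('a \<Rightarrow> 'a \<Rightarrow> real) \<Rightarrow> 'b set \<Rightarrow> ('b \<Rightarrow> 'b \<Rightarrow> real) \<Rightarrow> ereal" where
  "GH_dist p X dX Y dY =
     ereal (two_powr_neg_inv p) *
     (INF R \<in> {R. correspondence X Y R}.
        SUP ((x, y), (x', y')) \<in> R \<times> R. ereal (Lambda p (dX x x') (dY y y')))"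

text \<open>The block containing \<open>x\<close> at level \<open>t\<close> of the dendrogram associated with an ultrametric.\<close>

definition dendrogram_block :: "'a set \<Rightarrow> ('a \<Rightarrow> 'a \<Rightarrow> real) \<Rightarrow> real \<Rightarrow> 'a \<Rightarrow> 'a set" where
  "dendrogram_block X u t x = {x' \<in> X. u x x' \<le> t}"

definition dendrogram :: "'a set \<Rightarrow> ('a \<Rightarrow> 'a \<Rightarrow> real) \<Rightarrow> real \<Rightarrow> 'a set set" where
  "dendrogram X u t = dendrogram_block X u t ` X"

lemma (in Ultrametric_space) partition_on_dendrogram:
  assumes "0 \<le> t"
  shows "partition_on M (dendrogram M d t)"
proof -
  have self: "x \<in> dendrogram_block M d t x" if "x \<in> M" for x
    using that assms by (simp add: dendrogram_block_def)
  have eq: "dendrogram_block M d t x \<subseteq> dendrogram_block M d t y"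
    if "x \<in> M" "y \<in> M" "z \<in> dendrogram_block M d t x" "z \<in> dendrogram_block M d t y" for x y z
  proof
    fix w assume w: "w \<in> dendrogram_block M d t x"
    have "d x w \<le> t" "d z x \<le> t" "d y z \<le> t" "w \<in> M" "z \<in> M"
      using w that by (auto simp: dendrogram_block_def commute)
    moreover have "d y w \<le> max (d y z) (d z w)" "d z w \<le> max (d z x) (d x w)"
      using that calculation by (auto intro!: strong_triangle)
    ultimately show "w \<in> dendrogram_block M d t y"
      by (auto simp: dendrogram_block_def)
  qed
  show ?thesis
  proof (rule partition_onI)
    show "\<Union> (dendrogram M d t) = M"
      using self by (auto simp: dendrogram_def dendrogram_block_def)
    show "disjnt B C" if BC: "B \<in> dendrogram M d t" "C \<in> dendrogram M d t" "B \<noteq> C" for B C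
    proof -
      obtain x y where "x \<in> M" "y \<in> M"
        "B = dendrogram_block M d t x" "C = dendrogram_block M d t y"
        using BC by (auto simp: dendrogram_def)
      moreover have "z \<in> M" if "z \<in> B" for z
        using that calculation by (simp add: dendrogram_block_def)
      ultimately show ?thesis
        using eq[of x y] eq[of y x] \<open>B \<noteq> C\<close> unfolding disjnt_iff by blast
    qed
    show "{} \<notin> dendrogram M d t"
      using self by (auto simp: dendrogram_def)
  qed
qed

definition interleaved ::
  "ereal \<Rightarrow> real \<Rightarrow> 'a set \<Rightarrow> ('a \<Rightarrow> 'a \<Rightarrow> real) \<Rightarrow> 'b set \<Rightarrow> ('b \<Rightarrow> 'b \<Rightarrow> real) \<Rightarrow> bool" where
  "interleaved p \<epsilon> X uX Y uY \<longleftrightarrow>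
     (\<exists>\<phi> \<in> X \<rightarrow> Y. \<exists>\<psi> \<in> Y \<rightarrow> X. \<forall>t\<ge>0. \<forall>x\<in>X. \<forall>y\<in>Y.
        \<phi> ` dendrogram_block X uX t x \<subseteq> dendrogram_block Y uY (boxplus p t \<epsilon>) (\<phi> x) \<and>
        \<psi> ` dendrogram_block Y uY t y \<subseteq> dendrogram_block X uX (boxplus p t \<epsilon>) (\<psi> y) \<and>
        dendrogram_block X uX (boxplus p (boxplus p t \<epsilon>) \<epsilon>) x =
          dendrogram_block X uX (boxplus p (boxplus p t \<epsilon>) \<epsilon>) (\<psi> (\<phi> x)) \<and>
        dendrogram_block Y uY (boxplus p (boxplus p t \<epsilon>) \<epsilon>) y =
          dendrogram_block Y uY (boxplus p (boxplus p t \<epsilon>) \<epsilon>) (\<phi> (\<psi> y)))"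

definition interleaving_dist ::
  "ereal \<Rightarrow> 'a set \<Rightarrow> ('a \<Rightarrow> 'a \<Rightarrow> real) \<Rightarrow> 'b set \<Rightarrow> ('b \<Rightarrow> 'b \<Rightarrow> real) \<Rightarrow> ereal" where
  "interleaving_dist p X uX Y uY = (INF \<epsilon> \<in> {\<epsilon>. 0 < \<epsilon> \<and> interleaved p \<epsilon> X uX Y uY}. ereal \<epsilon>)"

end

(* By the strong triangle inequality two points have the same block at level t iff they are within
   distance t, so interleaving maps phi, psi are just maps that expand distances by at most
   boxplus p _ eps and whose composites move points by at most boxplus p eps eps. On the other side,
   Lambda p a b <= r means that a and b exceed each other by at most boxplus p _ r. Hence selections
   from a correspondence of distortion at most eps are eps-interleaving maps; conversely the union
   of the graph of phi and the transposed graph of psi has distortion at most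
   boxplus p eps eps = 2^(1/p) eps, and the factor 2^(-1/p) of the Gromov-Hausdorff distance
   restores eps. *)
theory Submission
  imports Defs
begin

section \<open>Arithmetic of \<open>boxplus\<close> and \<open>Lambda\<close>\<close>

lemma one_le_ereal_cases:
  assumes "(1::ereal) \<le> p"
  obtains "p = \<infinity>" | q where "p = ereal q" and "1 \<le> q"
  using assms by (cases p) (auto simp: one_ereal_def)

lemma boxplus_mono:
  assumes "1 \<le> p" "0 \<le> a" "a \<le> a'" "0 \<le> b" "b \<le> b'"
  shows "boxplus p a b \<le> boxplus p a' b'"
  using assms(1)
proof (cases rule: one_le_ereal_cases)
  case 1
  then show ?thesis using assms by (auto simp: boxplus_def)
next
  case (2 q)
  have "a powr q \<le> a' powr q" "b powr q \<le> b' powr q"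
    using assms 2 by (auto intro!: powr_mono2)
  then show ?thesis
    using 2 by (auto simp: boxplus_def intro!: powr_mono2 add_mono)
qed

lemma boxplus_commute: "boxplus p a b = boxplus p b a"
  by (simp add: boxplus_def max.commute add.commute)

lemma boxplus_zero_left:
  assumes "1 \<le> p" "0 \<le> a"
  shows "boxplus p 0 a = a"
  using assms(1) by (cases rule: one_le_ereal_cases) (use assms in \<open>auto simp: boxplus_def powr_powr\<close>)

lemma le_boxplus:
  assumes "1 \<le> p" "0 \<le> a" "0 \<le> b"
  shows le_boxplus_left: "a \<le> boxplus p a b" and le_boxplus_right: "b \<le> boxplus p a b"
  using boxplus_mono[of p 0 b a a] boxplus_mono[of p 0 a b b] assms
  by (simp_all add: boxplus_zero_left boxplus_commute[of p a b])

text \<open>For finite p = q the two equal summands produce a factor 2^(1/q), which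
  \<open>two_powr_neg_inv p\<close> cancels; for p = infinity the maximum is idempotent and the
  factor is 1.\<close>

lemma boxplus_self:
  assumes "1 \<le> p" "0 \<le> a"
  shows "two_powr_neg_inv p * boxplus p a a = a"
  using assms(1)
proof (cases rule: one_le_ereal_cases)
  case 1
  then show ?thesis by (simp add: boxplus_def two_powr_neg_inv_def)
next
  case (2 q)
  then have "a powr q + a powr q = 2 * a powr q" by simp
  then have "boxplus p a a = 2 powr (1 / q) * a"
    using 2 assms(2) by (simp add: boxplus_def powr_mult powr_powr)
  moreover have "two_powr_neg_inv p = 2 powr (- (1 / q))"
    using 2 by (simp add: two_powr_neg_inv_def one_ereal_def)
  ultimately show ?thesis
    by (simp add: powr_minus)
qed

text \<open>For finite p this is the splitting of an absolute value bound on a^q - b^q into two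
  one-sided bounds. For p = infinity, the larger of two distinct numbers can meet its bound only by
  being at most r.\<close>

lemma Lambda_le_iff:
  assumes "1 \<le> p" "0 \<le> a" "0 \<le> b" "0 \<le> r"
  shows "Lambda p a b \<le> r \<longleftrightarrow> a \<le> boxplus p b r \<and> b \<le> boxplus p a r"
  using assms(1)
proof (cases rule: one_le_ereal_cases)
  case 1
  then show ?thesis using assms by (auto simp: Lambda_def boxplus_def)
next
  case (2 q)
  \<comment> \<open>\<open>Lambda\<close> and \<open>boxplus\<close> both end in a q-th root. Root
    and power are monotone and mutually inverse on nonnegative reals, so these two rules clear the
    root on either side of an inequality.\<close>
  have powr_le_iff: "s powr (1 / q) \<le> t \<longleftrightarrow> s \<le> t powr q"
    if "0 \<le> s" "0 \<le> t" for s t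
    using that 2 powr_mono2[of "1/q" s "t powr q"] powr_mono2[of q "s powr (1/q)" t]
    by (auto simp: powr_powr)
  have le_powr_iff: "t \<le> s powr (1 / q) \<longleftrightarrow> t powr q \<le> s"
    if "0 \<le> s" "0 \<le> t" for s t
    using that 2 powr_mono2[of "1/q" "t powr q" s] powr_mono2[of q t "s powr (1/q)"]
    by (auto simp: powr_powr)
  show ?thesis
    using 2 assms by (auto simp: Lambda_def boxplus_def powr_le_iff le_powr_iff)
qed

section \<open>Dendrogram blocks and interleavings as distance conditions\<close>

text \<open>Every point of a closed ultrametric ball is a centre of it. Conversely, y lies in its
  own block because the level is nonnegative.\<close>

lemma (in Ultrametric_space) dendrogram_block_eq_iff:
  assumes "x \<in> M" "y \<in> M" "0 \<le> t"
  shows "dendrogram_block M d t x = dendrogram_block M d t y \<longleftrightarrow> d x y \<le> t"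
proof
  assume "dendrogram_block M d t x = dendrogram_block M d t y"
  moreover have "y \<in> dendrogram_block M d t y"
    using assms by (simp add: dendrogram_block_def)
  ultimately show "d x y \<le> t"
    by (auto simp: dendrogram_block_def)
next
  assume le: "d x y \<le> t"
  have "d x z \<le> t \<longleftrightarrow> d y z \<le> t" if "z \<in> M" for z
    using strong_triangle[of x y z] strong_triangle[of y x z] that assms le commute[of x y]
    by auto
  then show "dendrogram_block M d t x = dendrogram_block M d t y"
    by (auto simp: dendrogram_block_def)
qed

text \<open>Eliminates the level t. Each family of block conditions is decided at its sharpest
  level: the distance of the two points for the expansion bounds, and 0 for the composites.
  Monotonicity of \<open>boxplus\<close> yields all other levels.\<close>

lemma interleaved_iff:
  assumes "Ultrametric_space X uX" "Ultrametric_space Y uY" "X \<noteq> {}" "Y \<noteq> {}"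
    and p: "1 \<le> p" and e: "0 \<le> \<epsilon>"
  shows "interleaved p \<epsilon> X uX Y uY \<longleftrightarrow>
    (\<exists>\<phi> \<in> X \<rightarrow> Y. \<exists>\<psi> \<in> Y \<rightarrow> X.
      (\<forall>x\<in>X. \<forall>x'\<in>X. uY (\<phi> x) (\<phi> x') \<le> boxplus p (uX x x') \<epsilon>) \<and>
      (\<forall>y\<in>Y. \<forall>y'\<in>Y. uX (\<psi> y) (\<psi> y') \<le> boxplus p (uY y y') \<epsilon>) \<and>
      (\<forall>x\<in>X. uX x (\<psi> (\<phi> x)) \<le> boxplus p \<epsilon> \<epsilon>) \<and>
      (\<forall>y\<in>Y. uY y (\<phi> (\<psi> y)) \<le> boxplus p \<epsilon> \<epsilon>))"
    (is "_ \<longleftrightarrow> (\<exists>\<phi> \<in> _. \<exists>\<psi> \<in> _. ?I \<phi> \<psi>)")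
proof -
  interpret X: Ultrametric_space X uX by fact
  interpret Y: Ultrametric_space Y uY by fact
  have nonneg2: "0 \<le> boxplus p (boxplus p t \<epsilon>) \<epsilon>" if "0 \<le> t" for t
    using that e le_boxplus_right[OF p _ e] le_boxplus_right[OF p that e] by (meson order_trans)
  have mono2: "boxplus p \<epsilon> \<epsilon> \<le> boxplus p (boxplus p t \<epsilon>) \<epsilon>" if "0 \<le> t" for t
    using that e p by (intro boxplus_mono le_boxplus_right) auto
  have zero2: "boxplus p (boxplus p 0 \<epsilon>) \<epsilon> = boxplus p \<epsilon> \<epsilon>"
    using e p by (simp add: boxplus_zero_left)
  have "(\<forall>t\<ge>0. \<forall>x\<in>X. \<forall>y\<in>Y.
        \<phi> ` dendrogram_block X uX t x \<subseteq> dendrogram_block Y uY (boxplus p t \<epsilon>) (\<phi> x) \<and>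
        \<psi> ` dendrogram_block Y uY t y \<subseteq> dendrogram_block X uX (boxplus p t \<epsilon>) (\<psi> y) \<and>
        dendrogram_block X uX (boxplus p (boxplus p t \<epsilon>) \<epsilon>) x =
          dendrogram_block X uX (boxplus p (boxplus p t \<epsilon>) \<epsilon>) (\<psi> (\<phi> x)) \<and>
        dendrogram_block Y uY (boxplus p (boxplus p t \<epsilon>) \<epsilon>) y =
          dendrogram_block Y uY (boxplus p (boxplus p t \<epsilon>) \<epsilon>) (\<phi> (\<psi> y))) \<longleftrightarrow> ?I \<phi> \<psi>"
    (is "?L \<longleftrightarrow> _") if phi: "\<phi> \<in> X \<rightarrow> Y" and psi: "\<psi> \<in> Y \<rightarrow> X" for \<phi> \<psi>
  proof
    assume L: ?L
    \<comment> \<open>The definition quantifies over x and y jointly, so a condition on x alone is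
      extracted with a dummy point of Y, and vice versa.\<close>
    obtain x0 y0 where ne: "x0 \<in> X" "y0 \<in> Y" using assms by auto
    have "uY (\<phi> x) (\<phi> x') \<le> boxplus p (uX x x') \<epsilon>" if "x \<in> X" "x' \<in> X" for x x'
    proof -
      \<comment> \<open>The level \<open>uX x x'\<close> is the smallest one at which x' belongs to
        the block of x.\<close>
      have "\<phi> ` dendrogram_block X uX (uX x x') x
          \<subseteq> dendrogram_block Y uY (boxplus p (uX x x') \<epsilon>) (\<phi> x)"
        using L that ne by simp
      moreover have "x' \<in> dendrogram_block X uX (uX x x') x"
        using that by (simp add: dendrogram_block_def)
      ultimately show ?thesis
        by (auto simp: dendrogram_block_def)
    qed
    moreover have "uX (\<psi> y) (\<psi> y') \<le> boxplus p (uY y y') \<epsilon>" if "y \<in> Y" "y' \<in> Y" for y y'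
    proof -
      have "\<psi> ` dendrogram_block Y uY (uY y y') y
          \<subseteq> dendrogram_block X uX (boxplus p (uY y y') \<epsilon>) (\<psi> y)"
        using L that ne by simp
      moreover have "y' \<in> dendrogram_block Y uY (uY y y') y"
        using that by (simp add: dendrogram_block_def)
      ultimately show ?thesis
        by (auto simp: dendrogram_block_def)
    qed
    moreover have "uX x (\<psi> (\<phi> x)) \<le> boxplus p \<epsilon> \<epsilon>" if "x \<in> X" for x
    proof -
      have "\<psi> (\<phi> x) \<in> X" using that phi psi by auto
      then show ?thesis
        using L[rule_format, of 0 x y0] that ne nonneg2[of 0]
        by (simp add: zero2 X.dendrogram_block_eq_iff)
    qed
    moreover have "uY y (\<phi> (\<psi> y)) \<le> boxplus p \<epsilon> \<epsilon>" if "y \<in> Y" for y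
    proof -
      have "\<phi> (\<psi> y) \<in> Y" using that phi psi by auto
      then show ?thesis
        using L[rule_format, of 0 x0 y] that ne nonneg2[of 0]
        by (simp add: zero2 Y.dendrogram_block_eq_iff)
    qed
    ultimately show "?I \<phi> \<psi>" by blast
  next
    assume I: "?I \<phi> \<psi>"
    show ?L
    proof (intro allI impI ballI conjI)
      fix t :: real and x y assume t: "0 \<le> t" and xy: "x \<in> X" "y \<in> Y"
      have in_Y: "\<phi> x \<in> Y" "\<phi> (\<psi> y) \<in> Y" and in_X: "\<psi> y \<in> X" "\<psi> (\<phi> x) \<in> X"
        using phi psi xy by auto
      have le: "boxplus p s \<epsilon> \<le> boxplus p t \<epsilon>" if "0 \<le> s" "s \<le> t" for s
        using that p e by (intro boxplus_mono) auto
      show "\<phi> ` dendrogram_block X uX t x \<subseteq> dendrogram_block Y uY (boxplus p t \<epsilon>) (\<phi> x)"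
      proof (rule image_subsetI)
        fix x' assume "x' \<in> dendrogram_block X uX t x"
        then have "x' \<in> X" "uX x x' \<le> t" by (auto simp: dendrogram_block_def)
        moreover have "uY (\<phi> x) (\<phi> x') \<le> boxplus p (uX x x') \<epsilon>"
          using I xy \<open>x' \<in> X\<close> by blast
        ultimately show "\<phi> x' \<in> dendrogram_block Y uY (boxplus p t \<epsilon>) (\<phi> x)"
          using phi le[OF X.nonneg, of x x'] by (auto simp: dendrogram_block_def)
      qed
      show "\<psi> ` dendrogram_block Y uY t y \<subseteq> dendrogram_block X uX (boxplus p t \<epsilon>) (\<psi> y)"
      proof (rule image_subsetI)
        fix y' assume "y' \<in> dendrogram_block Y uY t y"
        then have "y' \<in> Y" "uY y y' \<le> t" by (auto simp: dendrogram_block_def)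
        moreover have "uX (\<psi> y) (\<psi> y') \<le> boxplus p (uY y y') \<epsilon>"
          using I xy \<open>y' \<in> Y\<close> by blast
        ultimately show "\<psi> y' \<in> dendrogram_block X uX (boxplus p t \<epsilon>) (\<psi> y)"
          using psi le[OF Y.nonneg, of y y'] by (auto simp: dendrogram_block_def)
      qed
      \<comment> \<open>Raising the level from 0 to t only weakens the bound on the
        composite.\<close>
      have "uX x (\<psi> (\<phi> x)) \<le> boxplus p (boxplus p t \<epsilon>) \<epsilon>"
        using I xy mono2[OF t] by (meson order_trans)
      then show "dendrogram_block X uX (boxplus p (boxplus p t \<epsilon>) \<epsilon>) x =
          dendrogram_block X uX (boxplus p (boxplus p t \<epsilon>) \<epsilon>) (\<psi> (\<phi> x))"
        using X.dendrogram_block_eq_iff[OF xy(1) in_X(2) nonneg2[OF t]] by simp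
      have "uY y (\<phi> (\<psi> y)) \<le> boxplus p (boxplus p t \<epsilon>) \<epsilon>"
        using I xy mono2[OF t] by (meson order_trans)
      then show "dendrogram_block Y uY (boxplus p (boxplus p t \<epsilon>) \<epsilon>) y =
          dendrogram_block Y uY (boxplus p (boxplus p t \<epsilon>) \<epsilon>) (\<phi> (\<psi> y))"
        using Y.dendrogram_block_eq_iff[OF xy(2) in_Y(2) nonneg2[OF t]] by simp
    qed
  qed
  then show ?thesis
    unfolding interleaved_def by (intro bex_cong refl)
qed

section \<open>Passing between correspondences and interleavings\<close>

text \<open>Arbitrary selections of R in the two directions work: the halves of
  \<open>Lambda_le_iff\<close> are the expansion bounds, and the composites are controlled by pairs
  of R that share a coordinate.\<close>

lemma interleaved_if_distortion_le:
  assumes "Ultrametric_space X uX" "Ultrametric_space Y uY" "X \<noteq> {}" "Y \<noteq> {}"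
    and p: "1 \<le> p" and e: "0 \<le> \<epsilon>"
    and R: "correspondence X Y R"
    and dis: "\<And>x y x' y'. (x, y) \<in> R \<Longrightarrow> (x', y') \<in> R \<Longrightarrow> Lambda p (uX x x') (uY y y') \<le> \<epsilon>"
  shows "interleaved p \<epsilon> X uX Y uY"
proof -
  interpret X: Ultrametric_space X uX by fact
  interpret Y: Ultrametric_space Y uY by fact
  have RXY: "R \<subseteq> X \<times> Y" using R by (simp add: correspondence_def)
  have "\<forall>x\<in>X. \<exists>y. (x, y) \<in> R" "\<forall>y\<in>Y. \<exists>x. (x, y) \<in> R"
    using R by (force simp: correspondence_def)+
  then obtain \<phi> \<psi> where phi: "\<And>x. x \<in> X \<Longrightarrow> (x, \<phi> x) \<in> R" and psi: "\<And>y. y \<in> Y \<Longrightarrow> (\<psi> y, y) \<in> R"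
    by metis
  have le: "uX x x' \<le> boxplus p (uY y y') \<epsilon>" "uY y y' \<le> boxplus p (uX x x') \<epsilon>"
    if "(x, y) \<in> R" "(x', y') \<in> R" for x y x' y'
    using dis[OF that] Lambda_le_iff[OF p X.nonneg Y.nonneg e] by blast+
  have phi_in: "\<phi> \<in> X \<rightarrow> Y" and psi_in: "\<psi> \<in> Y \<rightarrow> X"
    using phi psi RXY by auto
  have eps: "\<epsilon> \<le> boxplus p \<epsilon> \<epsilon>"
    using le_boxplus_left[OF p e e] .
  have "uX x (\<psi> (\<phi> x)) \<le> boxplus p \<epsilon> \<epsilon>" if "x \<in> X" for x
  proof -
    have "\<phi> x \<in> Y" using phi_in that by auto
    \<comment> \<open>The pairs (x, \<open>\<phi> x\<close>) and (\<open>\<psi> (\<phi> x)\<close>,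
      \<open>\<phi> x\<close>) have the same second coordinate, so the distance in Y is 0 and the
      bound is even \<epsilon>.\<close>
    then show ?thesis
      using le(1)[OF phi[OF that] psi[of "\<phi> x"]] eps e p by (simp add: boxplus_zero_left)
  qed
  moreover have "uY y (\<phi> (\<psi> y)) \<le> boxplus p \<epsilon> \<epsilon>" if "y \<in> Y" for y
  proof -
    have "\<psi> y \<in> X" using psi_in that by auto
    then show ?thesis
      using le(2)[OF psi[OF that] phi[of "\<psi> y"]] eps e p by (simp add: boxplus_zero_left)
  qed
  ultimately show ?thesis
    unfolding interleaved_iff[OF assms(1-6)]
    using phi_in psi_in le phi psi by (intro bexI[of _ \<phi>] bexI[of _ \<psi>]) auto
qed

text \<open>In an ultrametric the steps of a path do not add up: its longest step bounds the
  distance of its ends. The first step is written \<open>d b a\<close> so that both outer steps have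
  the shape in which they arise below, from an image point to an original one.\<close>

lemma (in Ultrametric_space) dist_le_three_steps:
  assumes "a \<in> M" "b \<in> M" "c \<in> M" "e \<in> M"
    and "d b a \<le> r" "d b c \<le> r" "d c e \<le> r"
  shows "d a e \<le> r"
  using strong_triangle[of a b e] strong_triangle[of b c e] commute[of a b] assms by auto

text \<open>Two pairs of the relation are compared by a path through the images under
  \<open>\<phi>\<close> or \<open>\<psi>\<close>, and the ultrametric inequality keeps the largest
  of the three errors instead of their sum.\<close>

lemma correspondence_if_interleaved:
  assumes "Ultrametric_space X uX" "Ultrametric_space Y uY" "X \<noteq> {}" "Y \<noteq> {}"
    and p: "1 \<le> p" and e: "0 \<le> \<epsilon>"
    and "interleaved p \<epsilon> X uX Y uY"
  obtains R where "correspondence X Y R"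
    and "\<And>x y x' y'. (x, y) \<in> R \<Longrightarrow> (x', y') \<in> R
      \<Longrightarrow> Lambda p (uX x x') (uY y y') \<le> boxplus p \<epsilon> \<epsilon>"
proof -
  interpret X: Ultrametric_space X uX by fact
  interpret Y: Ultrametric_space Y uY by fact
  obtain \<phi> \<psi> where phi: "\<phi> \<in> X \<rightarrow> Y" and psi: "\<psi> \<in> Y \<rightarrow> X"
    and expX: "\<And>x x'. x \<in> X \<Longrightarrow> x' \<in> X \<Longrightarrow> uY (\<phi> x) (\<phi> x') \<le> boxplus p (uX x x') \<epsilon>"
    and expY: "\<And>y y'. y \<in> Y \<Longrightarrow> y' \<in> Y \<Longrightarrow> uX (\<psi> y) (\<psi> y') \<le> boxplus p (uY y y') \<epsilon>"
    and compX: "\<And>x. x \<in> X \<Longrightarrow> uX x (\<psi> (\<phi> x)) \<le> boxplus p \<epsilon> \<epsilon>"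
    and compY: "\<And>y. y \<in> Y \<Longrightarrow> uY y (\<phi> (\<psi> y)) \<le> boxplus p \<epsilon> \<epsilon>"
    using assms(7) unfolding interleaved_iff[OF assms(1-6)] by blast
  define R where "R = {(x, y). x \<in> X \<and> y \<in> Y \<and> (y = \<phi> x \<or> x = \<psi> y)}"
  have e2: "0 \<le> boxplus p \<epsilon> \<epsilon>" and ee2: "\<epsilon> \<le> boxplus p \<epsilon> \<epsilon>"
    using le_boxplus_left[OF p e e] e by auto
  have "x \<in> fst ` R" if "x \<in> X" for x
    using that phi by (intro rev_image_eqI[of "(x, \<phi> x)"]) (auto simp: R_def)
  moreover have "y \<in> snd ` R" if "y \<in> Y" for y
    using that psi by (intro rev_image_eqI[of "(\<psi> y, y)"]) (auto simp: R_def)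
  ultimately have "correspondence X Y R"
    by (auto simp: correspondence_def R_def)
  moreover have "Lambda p (uX x x') (uY y y') \<le> boxplus p \<epsilon> \<epsilon>"
    if xy: "(x, y) \<in> R" "(x', y') \<in> R" for x y x' y'
  proof -
    have mem: "x \<in> X" "x' \<in> X" "y \<in> Y" "y' \<in> Y" "\<phi> x \<in> Y" "\<phi> x' \<in> Y" "\<psi> y \<in> X" "\<psi> y' \<in> X"
      using xy phi psi by (auto simp: R_def)
    \<comment> \<open>Whichever map produced the pair, one of the two distances is 0 and the other
      is the displacement of a point under a composite.\<close>
    have near: "uY (\<phi> a) b \<le> boxplus p \<epsilon> \<epsilon>" "uX (\<psi> b) a \<le> boxplus p \<epsilon> \<epsilon>"
      if "(a, b) \<in> R" for a b
    proof -
      have "a \<in> X" "b \<in> Y" "\<phi> a \<in> Y" "\<psi> b \<in> X" and "b = \<phi> a \<or> a = \<psi> b"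
        using that phi psi by (auto simp: R_def)
      then show "uY (\<phi> a) b \<le> boxplus p \<epsilon> \<epsilon>" "uX (\<psi> b) a \<le> boxplus p \<epsilon> \<epsilon>"
        using compX[of a] compY[of b] e2 X.commute[of "\<psi> b" a] Y.commute[of "\<phi> a" b] by auto
    qed
    have mono: "boxplus p s \<epsilon> \<le> boxplus p s (boxplus p \<epsilon> \<epsilon>)" if "0 \<le> s" for s
      using that p e ee2 by (intro boxplus_mono) auto
    have right: "boxplus p \<epsilon> \<epsilon> \<le> boxplus p s (boxplus p \<epsilon> \<epsilon>)" if "0 \<le> s" for s
      using that p e2 by (intro le_boxplus_right) auto
    have "uY y y' \<le> boxplus p (uX x x') (boxplus p \<epsilon> \<epsilon>)"
    \<comment> \<open>Path y, \<open>\<phi> x\<close>, \<open>\<phi> x'\<close>, y'. The outer steps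
      are bounded by \<open>near\<close>, the middle one by the expansion bound, where \<epsilon> is
      enlarged to \<open>boxplus p \<epsilon> \<epsilon>\<close>.\<close>
    proof (rule Y.dist_le_three_steps[of y "\<phi> x" "\<phi> x'"])
      show "uY (\<phi> x) y \<le> boxplus p (uX x x') (boxplus p \<epsilon> \<epsilon>)"
        "uY (\<phi> x') y' \<le> boxplus p (uX x x') (boxplus p \<epsilon> \<epsilon>)"
        using near(1) xy right[OF X.nonneg] by (meson order_trans)+
      show "uY (\<phi> x) (\<phi> x') \<le> boxplus p (uX x x') (boxplus p \<epsilon> \<epsilon>)"
        using expX[of x x'] mem mono[OF X.nonneg, of x x'] by linarith
    qed (use mem in auto)
    moreover have "uX x x' \<le> boxplus p (uY y y') (boxplus p \<epsilon> \<epsilon>)"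
    proof (rule X.dist_le_three_steps[of x "\<psi> y" "\<psi> y'"])
      show "uX (\<psi> y) x \<le> boxplus p (uY y y') (boxplus p \<epsilon> \<epsilon>)"
        "uX (\<psi> y') x' \<le> boxplus p (uY y y') (boxplus p \<epsilon> \<epsilon>)"
        using near(2) xy right[OF Y.nonneg] by (meson order_trans)+
      show "uX (\<psi> y) (\<psi> y') \<le> boxplus p (uY y y') (boxplus p \<epsilon> \<epsilon>)"
        using expY[of y y'] mem mono[OF Y.nonneg, of y y'] by linarith
    qed (use mem in auto)
    ultimately show ?thesis
      using Lambda_le_iff[OF p X.nonneg Y.nonneg e2] by blast
  qed
  ultimately show ?thesis using that by blast
qed

theorem corollary6p15:
  fixes X :: "'a set" and uX :: "'a \<Rightarrow> 'a \<Rightarrow> real"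
    and Y :: "'b set" and uY :: "'b \<Rightarrow> 'b \<Rightarrow> real"
    and p :: ereal
  assumes "Ultrametric_space X uX" and "X \<noteq> {}"
    and "compact_space (Metric_space.mtopology X uX)"
    and "Ultrametric_space Y uY" and "Y \<noteq> {}"
    and "compact_space (Metric_space.mtopology Y uY)"
    and "1 \<le> p"
  shows "ereal (two_powr_neg_inv p) * interleaving_dist p X uX Y uY \<le> GH_dist p X uX Y uY
    \<and> GH_dist p X uX Y uY \<le> interleaving_dist p X uX Y uY"
proof -
  note spaces = assms(1,4,2,5,7)
  define dis where
    "dis R = (SUP ((x, y), (x', y')) \<in> R \<times> R. ereal (Lambda p (uX x x') (uY y y')))" for R
  have GH: "GH_dist p X uX Y uY
      = ereal (two_powr_neg_inv p) * (INF R \<in> {R. correspondence X Y R}. dis R)"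
    by (simp add: GH_dist_def dis_def)
  have c: "0 \<le> ereal (two_powr_neg_inv p)"
    by (simp add: two_powr_neg_inv_def)
  have "interleaving_dist p X uX Y uY \<le> dis R" if R: "correspondence X Y R" for R
  \<comment> \<open>An interleaving needs a positive real parameter, while \<open>dis R\<close> may
    be 0 or infinite. Hence the bound is proved for every s above \<open>dis R\<close>; only finite
    s requires an argument.\<close>
  proof (rule dense_ge)
    fix s assume s: "dis R < s"
    have dis_ge: "ereal (Lambda p (uX x x') (uY y y')) \<le> dis R"
      if "(x, y) \<in> R" "(x', y') \<in> R" for x y x' y'
      unfolding dis_def
      by (rule SUP_upper2[of "((x, y), (x', y'))"]) (use that in auto)
    \<comment> \<open>A pair in R is needed because an empty supremum in \<open>ereal\<close> would
      be minus infinity; it gives \<open>0 \<le> dis R\<close>, which makes s positive.\<close>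
    obtain x y where "(x, y) \<in> R"
      using R \<open>X \<noteq> {}\<close> by (force simp: correspondence_def)
    moreover have "0 \<le> Lambda p (uX x x) (uY y y)"
      using \<open>(x, y) \<in> R\<close> R Metric_space.nonneg Ultrametric_space.axioms(1)[OF assms(1)]
      by (fastforce simp: Lambda_def le_max_iff_disj)
    ultimately have "0 \<le> dis R"
      using dis_ge order_trans by (metis ereal_less_eq(5))
    show "interleaving_dist p X uX Y uY \<le> s"
    proof (cases s)
      case (real \<epsilon>)
      then have pos: "0 < \<epsilon>"
        using s \<open>0 \<le> dis R\<close> by (metis ereal_less(2) order_le_less_trans)
      have "Lambda p (uX x x') (uY y y') \<le> \<epsilon>" if "(x, y) \<in> R" "(x', y') \<in> R" for x y x' y'
        using order_trans[OF dis_ge[OF that] less_imp_le[OF s]] real by simp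
      then have "interleaved p \<epsilon> X uX Y uY"
        using interleaved_if_distortion_le[OF spaces _ R] pos by simp
      then show ?thesis
        using pos real by (auto simp: interleaving_dist_def intro: INF_lower)
    qed (use s in auto)
  qed
  then have lower: "ereal (two_powr_neg_inv p) * interleaving_dist p X uX Y uY \<le> GH_dist p X uX Y uY"
    unfolding GH by (intro ereal_mult_left_mono INF_greatest c) auto
  have "GH_dist p X uX Y uY \<le> ereal \<epsilon>" if "0 < \<epsilon>" and int: "interleaved p \<epsilon> X uX Y uY" for \<epsilon>
  proof -
    have e: "0 \<le> \<epsilon>" using that by simp
    obtain R where R: "correspondence X Y R"
      and le: "\<And>x y x' y'. (x, y) \<in> R \<Longrightarrow> (x', y') \<in> R
        \<Longrightarrow> Lambda p (uX x x') (uY y y') \<le> boxplus p \<epsilon> \<epsilon>"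
      using correspondence_if_interleaved[OF spaces e int] by blast
    have "(INF R \<in> {R. correspondence X Y R}. dis R) \<le> dis R"
      using R by (auto intro: INF_lower)
    also have "\<dots> \<le> ereal (boxplus p \<epsilon> \<epsilon>)"
      unfolding dis_def by (rule SUP_least) (use le in auto)
    finally have "GH_dist p X uX Y uY \<le> ereal (two_powr_neg_inv p) * ereal (boxplus p \<epsilon> \<epsilon>)"
      unfolding GH by (rule ereal_mult_left_mono[OF _ c])
    then show ?thesis
      using boxplus_self[OF assms(7) e] by simp
  qed
  \<comment> \<open>Passing to the infimum also covers an empty set of parameters, whose infimum is
    infinity.\<close>
  then have "GH_dist p X uX Y uY \<le> interleaving_dist p X uX Y uY"
    unfolding interleaving_dist_def by (intro INF_greatest) auto
  with lower show ?thesis ..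
qed

end
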